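(* Let $P\subset\mathbb{R}^d$ be a $d$-polytope with $m$ facets and $Q\subset\mathbb{R}^{d'}$ a $d'$-polytope with $m'$ facets, and let $P\triangleleft Q$ be their wedge product. Let $H_0,\dots,H_{m-1}\subseteq[m']$. Then the vector $(H_0,\dots,H_{m-1})$ corresponds to a vertex of $P\triangleleft Q$ if and only if both of the following hold: (1) the set $\{i\in[m] : H_i=[m']\}\subseteq[m]$ corresponds to a vertex of $P$; and (2) each $H_i$ with $H_i\neq[m']$ corresponds to a vertex of $Q$.
   Context: Notation: $[n]=\{0,1,\dots,n-1\}$; $\mathbf 1$ is an all-ones column vector. $P=\{x\in\mathbb{R}^d : a_i x\le 1,\ i\in[m]\}$ is a $d$-polytope given by its (irredundant) facet inequalities, and $Q=\{y\in\mathbb{R}^{d'} : b_j y\le 1,\ j\in[m']\}$ likewise. The wedge product is the polytope $$P\triangleleft Q=\{(x,y_0,\dots,y_{m-1})\in\mathbb{R}^{d+md'} : a_i x+b_j y_i\le 1\ \text{for all } i\in[m],\ j\in[m']\},$$ where $x\in\mathbb{R}^d$ and each $y_i\in\mathbb{R}^{d'}$. Let $h_{i,j}$ denote the hyperplane $a_ix+b_jy_i=1$. A set $S\subseteq[m]$ corresponds to a face $G$ of $P$ if $S=\{i\in[m] : a_ix=1\text{ for all }x\in G\}$ (the set of indices of all facets containing $G$); similarly for $Q$. A vector $(H_0,\dots,H_{m-1})$ with $H_i\subseteq[m']$ corresponds to a face $G$ of $P\triangleleft Q$ if, for all $i,j$: $j\in H_i \iff G\subset h_{i,j}$. *)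

theory Defs
  imports "HOL-Analysis.Analysis"
begin

text \<open>
  The index sets $[m]$ and $[m']$ of the facets are finite types \<open>'m\<close> and \<open>'n\<close>, so that
  $m$ and $m'$ are their cardinalities and $[m']$ itself is \<^term>\<open>UNIV\<close>. Accordingly, the space
  $R^{d + m d'}$ containing the wedge product is \<^typ>\<open>(real^'d) \<times> (real^'e^'m)\<close>,
  with $y_i$ written \<open>y $ i\<close>.
\<close>

text \<open>
  \<open>facet_description P a\<close>: \<open>P\<close> is a full-dimensional polytope given by its
  facet inequalities $a_i x \le 1$. The bijection makes the system irredundant and
  says that the number of facets is the number of indices.
\<close>

definition facet_description :: "(real^'d) set \<Rightarrow> ('m::finite \<Rightarrow> real^'d) \<Rightarrow> bool" where
  "facet_description P a \<longleftrightarrow>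
     polytope P \<and> aff_dim P = int CARD('d) \<and>
     P = {x. \<forall>i. a i \<bullet> x \<le> 1} \<and>
     bij_betw (\<lambda>i. {x \<in> P. a i \<bullet> x = 1}) UNIV {F. F facet_of P}"

definition wedge_product ::
  "('m::finite \<Rightarrow> real^'d) \<Rightarrow> ('n::finite \<Rightarrow> real^'e) \<Rightarrow> ((real^'d) \<times> (real^'e^'m)) set" where
  "wedge_product a b = {(x, y). \<forall>i j. a i \<bullet> x + b j \<bullet> (y $ i) \<le> 1}"

definition wedge_hyperplane ::
  "('m::finite \<Rightarrow> real^'d) \<Rightarrow> ('n::finite \<Rightarrow> real^'e) \<Rightarrow> 'm \<Rightarrow> 'n
     \<Rightarrow> ((real^'d) \<times> (real^'e^'m)) set" where
  "wedge_hyperplane a b i j = {(x, y). a i \<bullet> x + b j \<bullet> (y $ i) = 1}"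

definition vertex_face :: "'a::euclidean_space set \<Rightarrow> 'a set \<Rightarrow> bool" where
  "vertex_face G P \<longleftrightarrow> G face_of P \<and> aff_dim G = 0"

definition corresponds_to_face ::
  "('m::finite \<Rightarrow> real^'d) \<Rightarrow> 'm set \<Rightarrow> (real^'d) set \<Rightarrow> bool" where
  "corresponds_to_face a S G \<longleftrightarrow> S = {i. \<forall>x\<in>G. a i \<bullet> x = 1}"

definition wedge_corresponds_to_face ::
  "('m::finite \<Rightarrow> real^'d) \<Rightarrow> ('n::finite \<Rightarrow> real^'e) \<Rightarrow> ('m \<Rightarrow> 'n set)
     \<Rightarrow> ((real^'d) \<times> (real^'e^'m)) set \<Rightarrow> bool" where
  "wedge_corresponds_to_face a b H G \<longleftrightarrow>
     (\<forall>i j. j \<in> H i \<longleftrightarrow> G \<subseteq> wedge_hyperplane a b i j)"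

end

theory Submission
  imports Defs
begin

text \<open>
  A point of a polyhedron is a vertex iff the constraints active there have trivial common kernel.
  For \<open>(x, y)\<close> in the wedge product put $s_i = 1 - a_i x$. As \<open>Q\<close> is bounded, its recession cone
  is trivial, so $s_i \ge 0$; if $s_i = 0$ then $y_i = 0$ and all $b_j$ are active, while for
  $s_i > 0$ the active $b_j$ are those of the point $y_i / s_i$ of \<open>Q\<close>, hence not all of them.
  A kernel direction $v$ at $x$ extends to the wedge product by $- (a_i v) y_i / s_i$.
\<close>

text \<open>A zero-dimensional face is a singleton, and \<open>{z}\<close> is a face exactly when
  \<open>z\<close> is an extreme point; this turns all three vertex conditions into statements about
  points.\<close>

lemma ex_vertex_face_iff:
  "(\<exists>G. vertex_face G R \<and> A G) \<longleftrightarrow> (\<exists>z. z extreme_point_of R \<and> A {z})"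
  unfolding vertex_face_def aff_dim_eq_0 by (metis face_of_singleton)

text \<open>A kernel direction of the active constraints allows a small move both ways inside the
  polyhedron. Conversely, along a segment with \<open>z\<close> in its interior every constraint
  active at \<open>z\<close> is constant, so the segment's direction lies in that kernel.\<close>

lemma extreme_point_of_polyhedron_iff:
  fixes c :: "'k::finite \<Rightarrow> 'a::euclidean_space"
  shows "z extreme_point_of {z. \<forall>k. c k \<bullet> z \<le> 1} \<longleftrightarrow>
    (\<forall>k. c k \<bullet> z \<le> 1) \<and> (\<forall>v. (\<forall>k. c k \<bullet> z = 1 \<longrightarrow> c k \<bullet> v = 0) \<longrightarrow> v = 0)"
    (is "z extreme_point_of ?R \<longleftrightarrow> ?in \<and> ?ker")
proof
  assume z: "z extreme_point_of ?R"
  then have "z \<in> ?R" by (simp add: extreme_point_of_def)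
  then have zin: ?in by simp
  have "v = 0" if v: "\<forall>k. c k \<bullet> z = 1 \<longrightarrow> c k \<bullet> v = 0" for v
  proof (rule ccontr)
    assume "v \<noteq> 0"
    have "\<forall>\<^sub>F e in at_right 0. \<bar>e * (c k \<bullet> v)\<bar> \<le> 1 - c k \<bullet> z" for k
    proof (cases "c k \<bullet> z = 1")
      case False
      then have "0 < 1 - c k \<bullet> z" using zin by (simp add: order_less_le)
      moreover have "((\<lambda>e. \<bar>e * (c k \<bullet> v)\<bar>) \<longlongrightarrow> \<bar>0 * (c k \<bullet> v)\<bar>) (at_right 0)"
        by (intro tendsto_intros)
      ultimately have "\<forall>\<^sub>F e in at_right 0. \<bar>e * (c k \<bullet> v)\<bar> < 1 - c k \<bullet> z"
        by (intro order_tendstoD(2)) auto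
      then show ?thesis by (rule eventually_mono) simp
    qed (use v in simp)
    then have "\<forall>\<^sub>F e in at_right 0. \<forall>k. \<bar>e * (c k \<bullet> v)\<bar> \<le> 1 - c k \<bullet> z"
      by (rule eventually_all_finite)
    moreover have "\<forall>\<^sub>F e in at_right (0::real). 0 < e"
      by (rule eventually_at_right_less)
    ultimately have "\<forall>\<^sub>F e in at_right 0. (\<forall>k. \<bar>e * (c k \<bullet> v)\<bar> \<le> 1 - c k \<bullet> z) \<and> 0 < e"
      by (rule eventually_conj)
    \<comment> \<open>One step length serves every constraint, as there are finitely many: inactive
      ones have positive slack, active ones do not change along \<open>v\<close>.\<close>
    then obtain e where e: "\<And>k. \<bar>e * (c k \<bullet> v)\<bar> \<le> 1 - c k \<bullet> z" "0 < e"
      using eventually_happens'[OF trivial_limit_at_right_real] by blast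
    have "c k \<bullet> (z - e *\<^sub>R v) \<le> 1 \<and> c k \<bullet> (z + e *\<^sub>R v) \<le> 1" for k
      using e(1)[of k] by (auto simp: inner_simps abs_le_iff)
    then have "z - e *\<^sub>R v \<in> ?R" "z + e *\<^sub>R v \<in> ?R" by auto
    moreover have "z = midpoint (z - e *\<^sub>R v) (z + e *\<^sub>R v)"
      by (simp add: midpoint_def scaleR_2[symmetric])
    moreover have "z - e *\<^sub>R v \<noteq> z + e *\<^sub>R v"
    proof
      assume "z - e *\<^sub>R v = z + e *\<^sub>R v"
      then have "(z + e *\<^sub>R v) - (z - e *\<^sub>R v) = 0" by simp
      then have "2 *\<^sub>R (e *\<^sub>R v) = 0" unfolding scaleR_2 by simp
      then show False using e(2) \<open>v \<noteq> 0\<close> by simp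
    qed
    ultimately show False
      using z midpoint_in_open_segment unfolding extreme_point_of_def by metis
  qed
  with zin show "?in \<and> ?ker" by blast
next
  assume asm: "?in \<and> ?ker"
  have False if p: "p \<in> ?R" and q: "q \<in> ?R" and z: "z \<in> open_segment p q" for p q
  proof -
    obtain u where u: "0 < u" "u < 1" "z = (1 - u) *\<^sub>R p + u *\<^sub>R q" and "p \<noteq> q"
      using z by (auto simp: in_segment)
    have "c k \<bullet> (p - q) = 0" if k: "c k \<bullet> z = 1" for k
    proof -
      \<comment> \<open>The slack at \<open>z\<close>, which is 0, is a convex combination with
        positive weights of the nonnegative slacks at \<open>p\<close> and \<open>q\<close>.\<close>
      have eq: "(1 - u) * (1 - c k \<bullet> p) + u * (1 - c k \<bullet> q) = 0"
        using k u(3) by (simp add: inner_simps algebra_simps)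
      have "0 \<le> (1 - u) * (1 - c k \<bullet> p)" "0 \<le> u * (1 - c k \<bullet> q)"
        using u p q by auto
      then have "(1 - u) * (1 - c k \<bullet> p) = 0" "u * (1 - c k \<bullet> q) = 0"
        using eq by linarith+
      then show ?thesis using u by (simp add: inner_simps)
    qed
    then have "p - q = 0" using asm by blast
    with \<open>p \<noteq> q\<close> show False by simp
  qed
  with asm show "z extreme_point_of ?R" by (auto simp: extreme_point_of_def)
qed

text \<open>The wedge product is itself a polyhedron: constraint (i, j) has the normal
  \<open>(a i, axis i (b j))\<close>, supported on \<open>x\<close> and block i of \<open>y\<close>,
  so the general criterion applies.\<close>

lemma extreme_point_of_wedge_product_iff:
  fixes a :: "'m::finite \<Rightarrow> real^'d" and b :: "'n::finite \<Rightarrow> real^'e"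
  shows "(x, y) extreme_point_of wedge_product a b \<longleftrightarrow>
    (\<forall>i j. a i \<bullet> x + b j \<bullet> (y $ i) \<le> 1) \<and>
    (\<forall>v w. (\<forall>i j. a i \<bullet> x + b j \<bullet> (y $ i) = 1 \<longrightarrow> a i \<bullet> v + b j \<bullet> (w $ i) = 0)
       \<longrightarrow> v = 0 \<and> w = 0)"
proof -
  define c where "c = (\<lambda>(i, j). (a i, axis i (b j) :: real^'e^'m))"
  have c: "c (i, j) \<bullet> (v, w) = a i \<bullet> v + b j \<bullet> (w $ i)" for i j v w
    by (simp add: c_def inner_axis')
  have "wedge_product a b = {z. \<forall>k. c k \<bullet> z \<le> 1}"
    by (auto simp: wedge_product_def c)
  then show ?thesis
    using extreme_point_of_polyhedron_iff[of "(x, y)" c]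
    by (simp add: c split_paired_all zero_prod_def)
qed

lemma bounded_halfspaces_recession_trivial:
  fixes b :: "'n \<Rightarrow> 'a::real_inner"
  assumes "bounded {y. \<forall>j. b j \<bullet> y \<le> 1}" and "\<And>j. b j \<bullet> w \<le> 0"
  shows "w = 0"
proof (rule ccontr)
  assume "w \<noteq> 0"
  obtain B where B: "\<And>y. \<forall>j. b j \<bullet> y \<le> 1 \<Longrightarrow> norm y \<le> B"
    using assms(1) unfolding bounded_iff by blast
  \<comment> \<open>This multiple of \<open>w\<close> has norm \<open>\<bar>B\<bar> + 1\<close>,
    just beyond the bound.\<close>
  define t where "t = (\<bar>B\<bar> + 1) / norm w"
  have "0 \<le> t" by (simp add: t_def)
  then have "b j \<bullet> (t *\<^sub>R w) \<le> 1" for j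
    using mult_nonneg_nonpos[OF _ assms(2)[of j], of t] by simp
  then have "norm (t *\<^sub>R w) \<le> B" using B by blast
  moreover have "norm (t *\<^sub>R w) = \<bar>B\<bar> + 1" using \<open>w \<noteq> 0\<close> by (simp add: t_def)
  ultimately show False by linarith
qed

theorem theorem2p11:
  fixes P :: "(real^'d) set" and a :: "'m::finite \<Rightarrow> real^'d"
    and Q :: "(real^'e) set" and b :: "'n::finite \<Rightarrow> real^'e"
    and H :: "'m \<Rightarrow> 'n set"
  assumes "facet_description P a"
    and "facet_description Q b"
  shows "(\<exists>G. vertex_face G (wedge_product a b) \<and> wedge_corresponds_to_face a b H G) \<longleftrightarrow>
    (\<exists>G. vertex_face G P \<and> corresponds_to_face a {i. H i = UNIV} G) \<and>
    (\<forall>i. H i \<noteq> UNIV \<longrightarrow> (\<exists>G. vertex_face G Q \<and> corresponds_to_face b (H i) G))"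
    (is "?L \<longleftrightarrow> ?R1 \<and> ?R2")
proof -
  have P: "P = {x. \<forall>i. a i \<bullet> x \<le> 1}" and Q: "Q = {y. \<forall>j. b j \<bullet> y \<le> 1}"
    and "polytope Q"
    using assms by (auto simp: facet_description_def)
  have bounded: "bounded {y. \<forall>j. b j \<bullet> y \<le> 1}"
    using polytope_imp_bounded[OF \<open>polytope Q\<close>] unfolding Q .
  have rec: "w = 0" if "\<And>j. b j \<bullet> w \<le> 0" for w
    using bounded_halfspaces_recession_trivial[OF bounded that] .
  \<comment> \<open>Depending on the sign of \<open>r\<close>, either \<open>w\<close> or
    \<open>- w\<close> is a recession direction of \<open>Q\<close>, hence zero.\<close>
  have const: "w = 0 \<and> r = 0" if w: "\<And>j. b j \<bullet> w = r" for w r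
  proof -
    have "w = 0 \<or> - w = 0"
      using rec[of w] rec[of "- w"] w by (cases "r \<le> 0") auto
    then show ?thesis using w by auto
  qed
  have L: "?L \<longleftrightarrow> (\<exists>x y. (x, y) extreme_point_of wedge_product a b \<and>
      (\<forall>i. H i = {j. a i \<bullet> x + b j \<bullet> (y $ i) = 1}))"
    by (simp add: ex_vertex_face_iff wedge_corresponds_to_face_def wedge_hyperplane_def set_eq_iff)
  have R1: "?R1 \<longleftrightarrow> (\<exists>x. x extreme_point_of P \<and> (\<forall>i. H i = UNIV \<longleftrightarrow> a i \<bullet> x = 1))"
    by (simp add: ex_vertex_face_iff corresponds_to_face_def set_eq_iff)
  have R2: "?R2 \<longleftrightarrow> (\<forall>i. H i \<noteq> UNIV \<longrightarrow>
      (\<exists>q. q extreme_point_of Q \<and> H i = {j. b j \<bullet> q = 1}))"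
    by (simp add: ex_vertex_face_iff corresponds_to_face_def)
  show ?thesis
  proof
    assume ?L
    then obtain x y where ext: "(x, y) extreme_point_of wedge_product a b"
      and H: "\<And>i. H i = {j. a i \<bullet> x + b j \<bullet> (y $ i) = 1}"
      using L by blast
    have le: "a i \<bullet> x + b j \<bullet> (y $ i) \<le> 1" for i j
      using ext extreme_point_of_wedge_product_iff by blast
    have ker: "v = 0 \<and> w = 0" if "\<And>i j. j \<in> H i \<Longrightarrow> a i \<bullet> v + b j \<bullet> (w $ i) = 0" for v w
      using ext that unfolding extreme_point_of_wedge_product_iff H by blast
    have xP: "a i \<bullet> x \<le> 1" for i
    proof (rule ccontr)
      assume *: "\<not> a i \<bullet> x \<le> 1"
      \<comment> \<open>Every \<open>b j\<close> is negative on \<open>y $ i\<close>, which makes it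
        a recession direction of \<open>Q\<close>.\<close>
      then have "y $ i = 0" using le[of i] by (intro rec) (smt (verit))
      then show False using * le[of i] by simp
    qed
    have full: "H i = UNIV \<longleftrightarrow> a i \<bullet> x = 1" for i
    proof
      assume "H i = UNIV"
      then have "b j \<bullet> (y $ i) = 1 - a i \<bullet> x" for j using H[of i] by (auto simp: set_eq_iff algebra_simps)
      from const[OF this] show "a i \<bullet> x = 1" by simp
    next
      assume *: "a i \<bullet> x = 1"
      then have "y $ i = 0" using le[of i] by (intro rec) (smt (verit))
      then show "H i = UNIV" using * H[of i] by simp
    qed
    have "v = 0" if v: "\<forall>i. a i \<bullet> x = 1 \<longrightarrow> a i \<bullet> v = 0" for v
    proof -
      \<comment> \<open>For \<open>j \<in> H i\<close> the value of \<open>b j\<close> on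
        \<open>y $ i\<close> is \<open>1 - a i \<bullet> x\<close>, so this \<open>w\<close> cancels
        \<open>a i \<bullet> v\<close>. Where \<open>a i \<bullet> x = 1\<close>, division by zero
        yields \<open>w $ i = 0\<close>, and \<open>a i \<bullet> v = 0\<close> by
        assumption.\<close>
      define w where "w = (\<chi> i. - ((a i \<bullet> v) / (1 - a i \<bullet> x)) *\<^sub>R (y $ i))"
      have "a i \<bullet> v + b j \<bullet> (w $ i) = 0" if "j \<in> H i" for i j
      proof (cases "a i \<bullet> x = 1")
        case False
        have "b j \<bullet> (y $ i) = 1 - a i \<bullet> x" using that H by (auto simp: algebra_simps)
        then show ?thesis using False by (simp add: w_def)
      qed (use v in \<open>simp add: w_def\<close>)
      then show ?thesis using ker by blast
    qed
    then have "x extreme_point_of P"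
      unfolding P extreme_point_of_polyhedron_iff using xP by blast
    then have ?R1 using R1 full by blast
    moreover have "\<exists>q. q extreme_point_of Q \<and> H i = {j. b j \<bullet> q = 1}" if "H i \<noteq> UNIV" for i
    proof -
      define s where "s = 1 - a i \<bullet> x"
      have s: "s > 0" using full[of i] that xP[of i] by (simp add: s_def order_less_le)
      \<comment> \<open>Dividing block i by its slack \<open>s\<close> normalizes its inequalities
        to those of \<open>Q\<close> and keeps the same ones active.\<close>
      define q where "q = (1 / s) *\<^sub>R (y $ i)"
      have Hq: "H i = {j. b j \<bullet> q = 1}"
        using s H[of i] by (auto simp: q_def s_def field_simps)
      have "b j \<bullet> q \<le> 1" for j
        using s le[of i j] by (simp add: q_def s_def field_simps)
      moreover have "w = 0" if w: "\<forall>j. b j \<bullet> q = 1 \<longrightarrow> b j \<bullet> w = 0" for w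
      proof -
        \<comment> \<open>A kernel direction at \<open>q\<close>, placed in block i with zeros
          elsewhere, is a kernel direction at \<open>(x, y)\<close>.\<close>
        have "a k \<bullet> 0 + b j \<bullet> (axis i w $ k) = 0" if "j \<in> H k" for k j
          using that w Hq by (auto simp: axis_def)
        then have "axis i w = 0" using ker by blast
        then show ?thesis by (simp add: axis_eq_0_iff)
      qed
      ultimately have "q extreme_point_of Q"
        unfolding Q extreme_point_of_polyhedron_iff by blast
      with Hq show ?thesis by blast
    qed
    then have ?R2 using R2 by blast
    ultimately show "?R1 \<and> ?R2" ..
  next
    assume R: "?R1 \<and> ?R2"
    obtain x where ext: "x extreme_point_of P"
      and full: "\<And>i. H i = UNIV \<longleftrightarrow> a i \<bullet> x = 1"
      using R R1 by blast
    obtain q where q: "\<And>i. H i \<noteq> UNIV \<Longrightarrow> q i extreme_point_of Q"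
      and Hq: "\<And>i. H i \<noteq> UNIV \<Longrightarrow> H i = {j. b j \<bullet> q i = 1}"
      using R R2 by metis
    have xP: "a i \<bullet> x \<le> 1" for i
      using ext unfolding P extreme_point_of_polyhedron_iff by blast
    have kerP: "v = 0" if "\<forall>i. a i \<bullet> x = 1 \<longrightarrow> a i \<bullet> v = 0" for v
      using ext that unfolding P extreme_point_of_polyhedron_iff by blast
    have qQ: "b j \<bullet> q i \<le> 1" if "H i \<noteq> UNIV" for i j
      using q[OF that] unfolding Q extreme_point_of_polyhedron_iff by blast
    have kerQ: "w = 0" if "H i \<noteq> UNIV" "\<forall>j. b j \<bullet> q i = 1 \<longrightarrow> b j \<bullet> w = 0" for i w
      using q[OF that(1)] that(2) unfolding Q extreme_point_of_polyhedron_iff by blast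
    \<comment> \<open>The scaling makes each slack of the wedge product factor into a slack of
      \<open>P\<close> and one of \<open>Q\<close>. Where \<open>H i = UNIV\<close> the point
      \<open>q i\<close> is unspecified, but its factor is 0.\<close>
    define y where "y = (\<chi> i. (1 - a i \<bullet> x) *\<^sub>R q i)"
    have y: "1 - (a i \<bullet> x + b j \<bullet> (y $ i)) = (1 - a i \<bullet> x) * (1 - b j \<bullet> q i)" for i j
      by (simp add: y_def algebra_simps)
    have le: "a i \<bullet> x + b j \<bullet> (y $ i) \<le> 1" for i j
    proof -
      have "0 \<le> (1 - a i \<bullet> x) * (1 - b j \<bullet> q i)"
        using xP[of i] qQ[of i j] full[of i] by (cases "a i \<bullet> x = 1") auto
      then show ?thesis using y[of i j] by linarith
    qed
    have active: "a i \<bullet> x + b j \<bullet> (y $ i) = 1 \<longleftrightarrow> a i \<bullet> x = 1 \<or> b j \<bullet> q i = 1" for i j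
      using y[of i j] by auto
    have H: "H i = {j. a i \<bullet> x + b j \<bullet> (y $ i) = 1}" for i
      using full[of i] Hq[of i] unfolding active by (cases "H i = UNIV") auto
    have "v = 0 \<and> w = 0"
      if vw: "\<forall>i j. a i \<bullet> x + b j \<bullet> (y $ i) = 1 \<longrightarrow> a i \<bullet> v + b j \<bullet> (w $ i) = 0" for v w
    proof -
      \<comment> \<open>On a facet through \<open>x\<close> the whole block is active, so all
        \<open>b j\<close> take the same value on \<open>w $ i\<close>, and \<open>const\<close>
        makes both this value and \<open>w $ i\<close> vanish.\<close>
      have S: "w $ i = 0 \<and> a i \<bullet> v = 0" if "a i \<bullet> x = 1" for i
      proof -
        have "b j \<bullet> (w $ i) = - (a i \<bullet> v)" for j
          using vw that active[of i j] by (metis add.commute eq_neg_iff_add_eq_0)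
        from const[OF this] show ?thesis by simp
      qed
      then have "v = 0" using kerP by blast
      \<comment> \<open>With \<open>v = 0\<close>, each remaining \<open>w $ i\<close> is a kernel
        direction at the vertex \<open>q i\<close> of \<open>Q\<close>.\<close>
      have "w $ i = 0" for i
      proof (cases "a i \<bullet> x = 1")
        case False
        moreover have "\<forall>j. b j \<bullet> q i = 1 \<longrightarrow> b j \<bullet> (w $ i) = 0"
          using vw unfolding active \<open>v = 0\<close> by simp
        ultimately show ?thesis using kerQ full by blast
      qed (use S in blast)
      with \<open>v = 0\<close> show ?thesis by (simp add: vec_eq_iff)
    qed
    then have "(x, y) extreme_point_of wedge_product a b"
      unfolding extreme_point_of_wedge_product_iff using le by blast
    then show ?L using L H by blast
  qed
qed

end
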